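(* If $A$ is a left brace whose cardinality is a cube-free number, then the socle of $A$ is nonzero. Moreover, $A$ is a left brace of a finite multipermutation level.
   Context: A left brace is an abelian group $(A,+)$ with a multiplication $\cdot$ such that $a\cdot(b+c)=a\cdot b+a\cdot c$ for all $a,b,c\in A$ and such that the circle operation $a\circ b=a\cdot b+a+b$ makes $A$ into a group. The socle of $A$ is $\mathrm{Soc}(A)=\{a\in A: a\cdot b=0 \text{ for all } b\in A\}$. Put $A^{(1)}=A$ and, for $n>1$, let $A^{(n)}=A^{(n-1)}\cdot A$ be the additive subgroup generated by all $x\cdot a$ with $x\in A^{(n-1)}$, $a\in A$. The left brace $A$ has a finite multipermutation level if $A^{(n)}=0$ for some $n$. A positive integer is cube-free if it is not divisible by the cube of any prime.
   Formalization: The claim that the socle is nonzero is stated for nonzero left braces only, since the one-element brace has cube-free cardinality 1 and zero socle; the finite multipermutation level is stated for all such left braces, including the zero brace. *)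

theory Defs
  imports
    "HOL-Algebra.Ring"
    "HOL-Algebra.Generated_Groups"
    "HOL-Computational_Algebra.Primes"
begin

(* A brace is carried by a ring record: \<oplus>, \<zero> give the additive group and \<otimes> is the
   brace multiplication, which need be neither associative nor right distributive.
   The field \<one> of the record is not used. *)

definition circ :: "('a, 'm) ring_scheme \<Rightarrow> 'a \<Rightarrow> 'a \<Rightarrow> 'a"
  where "circ A a b = a \<otimes>\<^bsub>A\<^esub> b \<oplus>\<^bsub>A\<^esub> a \<oplus>\<^bsub>A\<^esub> b"

(* The circle operation with identity \<zero>. Left distributivity gives a \<otimes> \<zero> = \<zero>, hence
   circ \<zero> \<zero> = \<zero>, so no other element can be the identity of a group under circ. *)
definition circ_monoid :: "('a, 'm) ring_scheme \<Rightarrow> 'a monoid"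
  where "circ_monoid A = \<lparr>carrier = carrier A, monoid.mult = circ A, one = \<zero>\<^bsub>A\<^esub>\<rparr>"

locale left_brace = abelian_group A for A (structure) +
  assumes brace_mult_closed:
      "\<lbrakk>a \<in> carrier A; b \<in> carrier A\<rbrakk> \<Longrightarrow> a \<otimes> b \<in> carrier A"
    and brace_left_distrib:
      "\<lbrakk>a \<in> carrier A; b \<in> carrier A; c \<in> carrier A\<rbrakk>
        \<Longrightarrow> a \<otimes> (b \<oplus> c) = a \<otimes> b \<oplus> a \<otimes> c"
    and circ_group: "group (circ_monoid A)"

definition socle :: "('a, 'm) ring_scheme \<Rightarrow> 'a set"
  where "socle A = {a \<in> carrier A. \<forall>b \<in> carrier A. a \<otimes>\<^bsub>A\<^esub> b = \<zero>\<^bsub>A\<^esub>}"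

(* The right series is indexed from 1; the value at 0 is a dummy. *)
fun right_series :: "('a, 'm) ring_scheme \<Rightarrow> nat \<Rightarrow> 'a set" where
  "right_series A 0 = carrier A"
| "right_series A (Suc 0) = carrier A"
| "right_series A (Suc (Suc n)) =
     generate (add_monoid A)
       {x \<otimes>\<^bsub>A\<^esub> a | x a. x \<in> right_series A (Suc n) \<and> a \<in> carrier A}"

definition finite_multipermutation_level :: "('a, 'm) ring_scheme \<Rightarrow> bool"
  where "finite_multipermutation_level A \<longleftrightarrow> (\<exists>n\<ge>1. right_series A n = {\<zero>\<^bsub>A\<^esub>})"

definition cube_free :: "nat \<Rightarrow> bool"
  where "cube_free n \<longleftrightarrow> n > 0 \<and> (\<forall>p. prime p \<longrightarrow> \<not> p ^ 3 dvd n)"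

end

theory Submission
  imports Defs "HOL-Algebra.Group_Action" "HOL-Algebra.Sylow" "HOL-Algebra.Multiplicative_Group"
    "HOL-Number_Theory.Cong"
begin

text \<open>
  The maps \<open>\<lambda>\<^sub>a(b) = a \<cdot> b + b\<close> define an action of the circle group by additive
  automorphisms whose kernel is the socle, and the primary components are left ideals. Let \<open>p\<close> be
  the largest prime divisor of \<open>|A|\<close>. A left ideal \<open>P\<close> of order \<open>p\<close> or \<open>p\<^sup>2\<close> contains a nonzero
  element acting trivially on \<open>P\<close>, and by counting fixed points a \<open>p\<close>-group acts trivially on a left
  ideal of order dividing \<open>q\<^sup>2\<close> with \<open>q < p\<close>, since \<open>p\<close> does not divide \<open>q\<^sup>2 - 1\<close>, unless \<open>p = 3\<close>
  and \<open>q = 2\<close>. In that case let \<open>V\<close> and \<open>W\<close> be the components at 2 and 3 and suppose that \<open>W\<close>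
  acts nontrivially on \<open>V\<close>. Then \<open>|V| = 4\<close>, the socle of \<open>V\<close> is \<open>W\<close>-stable and hence is all of \<open>V\<close>;
  consequently the fibres of \<open>W \<rightarrow> Aut(V)\<close> are \<open>V\<close>-stable. These have size 1 or 3, which forces some
  nonzero element of \<open>V\<close> to act trivially on \<open>W\<close>. Induction along \<open>A / Soc(A)\<close> gives the finite
  multipermutation level.
\<close>

section \<open>Fixed points of a \<open>p\<close>-group action, counted modulo
  \<open>p\<close>\<close>

lemma (in group_action) card_fixed_points_cong:
  assumes fin: "finite E" and p: "prime p" and ord: "order G = p ^ k"
  shows "[card E = card {x \<in> E. \<forall>g \<in> carrier G. \<phi> g x = x}] (mod p)"
proof -
  define F where "F = {x \<in> E. \<forall>g \<in> carrier G. \<phi> g x = x}"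
  have FE: "F \<subseteq> E" by (auto simp: F_def)
  have grp: "group G" using group_hom group_hom.axioms(1) by blast
  have orbit_sub: "orbit G \<phi> x \<subseteq> E" if "x \<in> E" for x
    using that element_image by (auto simp: orbit_def)
  have part: "partition E (orbits G E \<phi>)" by (rule orbit_partition)
  have disj: "O1 = O2" if "O1 \<in> orbits G E \<phi>" "O2 \<in> orbits G E \<phi>" "x \<in> O1" "x \<in> O2" for O1 O2 x
  proof -
    have "x \<in> E" using that orbit_sub by (auto simp: orbits_def)
    then show ?thesis using part that unfolding partition_def by blast
  qed
  \<comment> \<open>The fixed points are exactly the points with a one-element orbit, so
    \<open>R\<close> collects the orbits that cover the rest. Their sizes divide
    \<open>p ^ k\<close> and differ from 1, hence are multiples of \<open>p\<close>.\<close>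
  define R where "R = {Q \<in> orbits G E \<phi>. card Q \<noteq> 1}"
  have orbF: "orbit G \<phi> x = {x}" if "x \<in> F" for x
    using that grp orbit_refl[of x] by (auto simp: F_def orbit_def)
  have ER: "E - F = \<Union>R"
  proof (intro equalityI subsetI)
    fix x assume x: "x \<in> E - F"
    have "card (orbit G \<phi> x) \<noteq> 1"
    proof
      assume "card (orbit G \<phi> x) = 1"
      then obtain y where "orbit G \<phi> x = {y}" by (auto simp: card_1_singleton_iff)
      moreover have "x \<in> orbit G \<phi> x" using x orbit_refl by auto
      ultimately have "orbit G \<phi> x = {x}" by auto
      then have "x \<in> F" using x by (auto simp: F_def orbit_def)
      then show False using x by auto
    qed
    then have "orbit G \<phi> x \<in> R" using x by (auto simp: R_def orbits_def)
    then show "x \<in> \<Union>R" using x orbit_refl by auto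
  next
    fix x assume "x \<in> \<Union>R"
    then obtain Q where Q: "Q \<in> R" "x \<in> Q" by auto
    then have xE: "x \<in> E" using orbit_sub by (auto simp: R_def orbits_def)
    have "Q = orbit G \<phi> x"
      by (rule disj[of _ _ x]) (use Q xE orbit_refl in \<open>auto simp: R_def orbits_def\<close>)
    then have "x \<notin> F" using Q orbF by (auto simp: R_def)
    then show "x \<in> E - F" using xE by auto
  qed
  have "p dvd card (\<Union>R)"
  proof (rule dvd_partition)
    show "finite (\<Union>R)" using fin ER by (metis finite_Diff)
    show "\<forall>c\<in>R. p dvd card c"
    proof
      fix Q assume "Q \<in> R"
      then obtain x where x: "x \<in> E" "Q = orbit G \<phi> x" and c: "card Q \<noteq> 1"
        by (auto simp: R_def orbits_def)
      have "card Q dvd p ^ k" using orbit_stabilizer_theorem[OF x(1)] ord x(2)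
        by (metis dvd_triv_left)
      then obtain i where "card Q = p ^ i" using p divides_primepow_nat by auto
      then show "p dvd card Q" using c by (cases i) auto
    qed
    show "\<forall>c1\<in>R. \<forall>c2\<in>R. c1 \<noteq> c2 \<longrightarrow> c1 \<inter> c2 = {}"
      using disj by (fastforce simp: R_def)
  qed
  moreover have "card E = card F + card (\<Union>R)"
    using card_Un_disjoint[of F "E - F"] fin FE ER finite_subset
    by (metis Diff_disjoint Un_Diff_cancel finite_Diff sup.absorb2)
  ultimately show ?thesis unfolding F_def[symmetric]
    by (auto simp: cong_def)
qed

section \<open>The maps \<open>lam\<close>, left ideals and the action of the circle group\<close>

context left_brace
begin

abbreviation "C \<equiv> circ_monoid A"

sublocale circ: group C
  rewrites "carrier C = carrier A" and "monoid.mult C = circ A" and "monoid.one C = \<zero>"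
  using circ_group by (simp_all add: circ_monoid_def)

lemma circ_monoid_simps [simp]:
  "carrier C = carrier A" "monoid.mult C = circ A" "monoid.one C = \<zero>"
  by (simp_all add: circ_monoid_def)

definition lam where "lam a b = a \<otimes> b \<oplus> b"

lemma lam_closed [simp, intro]: "\<lbrakk>a \<in> carrier A; b \<in> carrier A\<rbrakk> \<Longrightarrow> lam a b \<in> carrier A"
  by (simp add: lam_def brace_mult_closed)

lemma circ_eq_add_lam: "\<lbrakk>a \<in> carrier A; b \<in> carrier A\<rbrakk> \<Longrightarrow> circ A a b = a \<oplus> lam a b"
  by (simp add: lam_def circ_def brace_mult_closed a_ac)

lemma lam_add: "\<lbrakk>a \<in> carrier A; b \<in> carrier A; c \<in> carrier A\<rbrakk> \<Longrightarrow> lam a (b \<oplus> c) = lam a b \<oplus> lam a c"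
  by (simp add: lam_def brace_mult_closed brace_left_distrib a_ac)

text \<open>Expand both bracketings of a triple circle product as a sum starting with
  \<open>circ A a b\<close> and cancel that summand.\<close>

lemma lam_circ:
  assumes "a \<in> carrier A" "b \<in> carrier A" "c \<in> carrier A"
  shows "lam (circ A a b) c = lam a (lam b c)"
proof -
  have "circ A a b \<oplus> lam (circ A a b) c = circ A (circ A a b) c"
    using assms by (simp add: circ_eq_add_lam)
  also have "\<dots> = circ A a (circ A b c)" using assms by (simp add: circ.m_assoc)
  also have "\<dots> = circ A a b \<oplus> lam a (lam b c)"
    using assms by (simp add: circ_eq_add_lam lam_add a_assoc)
  finally show ?thesis using assms by (simp)
qed

lemma lam_zero_left [simp]: "a \<in> carrier A \<Longrightarrow> lam \<zero> a = a"
  using circ_eq_add_lam[of \<zero> a] circ.l_one[of a] by simp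

lemma lam_zero_right [simp]: "a \<in> carrier A \<Longrightarrow> lam a \<zero> = \<zero>"
  using lam_add[of a \<zero> \<zero>] by (metis add.l_cancel_one' lam_closed r_zero zero_closed)

lemma lam_inv_lam [simp]:
  "\<lbrakk>a \<in> carrier A; b \<in> carrier A\<rbrakk> \<Longrightarrow> lam (inv\<^bsub>C\<^esub> a) (lam a b) = b"
  by (simp flip: lam_circ)

lemma lam_lam_inv [simp]:
  "\<lbrakk>a \<in> carrier A; b \<in> carrier A\<rbrakk> \<Longrightarrow> lam a (lam (inv\<^bsub>C\<^esub> a) b) = b"
  by (simp flip: lam_circ)

lemma lam_uminus:
  assumes "a \<in> carrier A" "b \<in> carrier A" shows "lam a (\<ominus> b) = \<ominus> lam a b"
  using lam_add[of a "\<ominus> b" b] assms by (simp add: l_neg minus_equality[symmetric])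

lemma lam_add_pow:
  fixes n :: nat
  assumes "a \<in> carrier A" "b \<in> carrier A" shows "lam a ([n] \<cdot> b) = [n] \<cdot> lam a b"
  using assms by (induction n) (simp_all add: lam_add)

text \<open>Since \<open>lam a b\<close> and \<open>a \<otimes> b\<close> differ by
  \<open>b\<close>, stability of an additive subgroup under \<open>lam\<close> is the same as
  stability under left multiplication.\<close>

definition left_ideal where
  "left_ideal I \<longleftrightarrow> subgroup I (add_monoid A) \<and> (\<forall>a\<in>carrier A. \<forall>b\<in>I. lam a b \<in> I)"

lemma left_ideal_lam: "\<lbrakk>left_ideal I; a \<in> carrier A; b \<in> I\<rbrakk> \<Longrightarrow> lam a b \<in> I"
  by (simp add: left_ideal_def)

lemma left_ideal_subset: "left_ideal I \<Longrightarrow> I \<subseteq> carrier A"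
  using subgroup.subset by (fastforce simp: left_ideal_def)

lemma left_ideal_zero: "left_ideal I \<Longrightarrow> \<zero> \<in> I"
  using subgroup.one_closed by (fastforce simp: left_ideal_def)

text \<open>The circle operations reduce to addition and \<open>lam\<close>: the product is
  \<open>a \<oplus> lam a b\<close>, and the circle inverse of \<open>a\<close> is its own
  \<open>lam\<close> applied to \<open>\<ominus> a\<close>.\<close>

lemma left_ideal_imp_subgroup_circ:
  assumes I: "left_ideal I" shows "subgroup I C"
proof
  have sub: "subgroup I (add_monoid A)" using I by (simp add: left_ideal_def)
  show "I \<subseteq> carrier C" using left_ideal_subset[OF I] by simp
  show "\<one>\<^bsub>C\<^esub> \<in> I" using left_ideal_zero[OF I] by simp
  fix a assume a: "a \<in> I"
  then have aA: "a \<in> carrier A" using left_ideal_subset[OF I] by auto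
  show "inv\<^bsub>C\<^esub> a \<in> I"
  proof -
    have "a \<oplus> lam a (inv\<^bsub>C\<^esub> a) = \<zero>" using aA by (simp flip: circ_eq_add_lam)
    then have "lam a (inv\<^bsub>C\<^esub> a) = \<ominus> a" using aA
      by (metis a_comm circ.inv_closed lam_closed minus_equality)
    then have "inv\<^bsub>C\<^esub> a = lam (inv\<^bsub>C\<^esub> a) (\<ominus> a)"
      using lam_inv_lam[OF aA, of "inv\<^bsub>C\<^esub> a"] aA by simp
    moreover have "\<ominus> a \<in> I" using add.subgroupE(3)[OF sub a] .
    ultimately show ?thesis using left_ideal_lam[OF I] aA by (metis circ.inv_closed)
  qed
  fix b assume b: "b \<in> I"
  then have "a \<oplus> lam a b \<in> I" using add.subgroupE(4)[OF sub a] left_ideal_lam[OF I aA b] by simp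
  then show "a \<otimes>\<^bsub>C\<^esub> b \<in> I" using aA b left_ideal_subset[OF I] by (simp add: circ_eq_add_lam subset_iff)
qed

text \<open>Every \<open>lam a\<close> is additive. This makes Lagrange available for fixed-point
  sets, which therefore have prime power order inside a left ideal of prime power order.\<close>

lemma subgroup_fixed:
  assumes I: "subgroup I (add_monoid A)" and H: "H \<subseteq> carrier A"
  shows "subgroup {b \<in> I. \<forall>a\<in>H. lam a b = b} (add_monoid A)"
proof -
  have IA: "I \<subseteq> carrier A" using subgroup.subset[OF I] by simp
  show ?thesis
  proof (rule add.subgroupI)
    show "{b \<in> I. \<forall>a\<in>H. lam a b = b} \<subseteq> carrier A" using IA by auto
    show "{b \<in> I. \<forall>a\<in>H. lam a b = b} \<noteq> {}"
      using subgroup.one_closed[OF I] H by (auto intro!: exI[of _ \<zero>])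
    fix b assume b: "b \<in> {b \<in> I. \<forall>a\<in>H. lam a b = b}"
    show "\<ominus> b \<in> {b \<in> I. \<forall>a\<in>H. lam a b = b}"
      using b IA H add.subgroupE(3)[OF I] by (auto simp: lam_uminus subset_iff)
    fix c assume c: "c \<in> {b \<in> I. \<forall>a\<in>H. lam a b = b}"
    show "b \<oplus> c \<in> {b \<in> I. \<forall>a\<in>H. lam a b = b}"
      using b c IA H add.subgroupE(4)[OF I] by (auto simp: lam_add subset_iff)
  qed
qed

text \<open>\<open>X\<close> is an arbitrary stable set, so that the action can also be studied on
  fibres. The maps are restricted because \<open>BijGroup X\<close> consists of extensional
  functions.\<close>

lemma group_action_lam:
  assumes H: "subgroup H C" and X: "X \<subseteq> carrier A" and st: "\<And>a x. \<lbrakk>a \<in> H; x \<in> X\<rbrakk> \<Longrightarrow> lam a x \<in> X"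
  shows "group_action (C\<lparr>carrier := H\<rparr>) X (\<lambda>a. \<lambda>x\<in>X. lam a x)"
proof -
  have HA: "H \<subseteq> carrier A" using subgroup.subset[OF H] by simp
  have bij: "(\<lambda>x\<in>X. lam a x) \<in> Bij X" if a: "a \<in> H" for a
  proof -
    have i: "inv\<^bsub>C\<^esub> a \<in> H" using subgroup.m_inv_closed[OF H a] .
    have "bij_betw (lam a) X X"
      by (rule bij_betw_byWitness[where f' = "lam (inv\<^bsub>C\<^esub> a)"])
        (use a i st X HA in \<open>auto simp: subset_iff\<close>)
    then show ?thesis by (simp add: Bij_def bij_betw_restrict_eq)
  qed
  show ?thesis
    unfolding group_action_def group_hom_def group_hom_axioms_def
  proof (intro conjI)
    show "group (C\<lparr>carrier := H\<rparr>)" using circ.subgroup_imp_group[OF H] .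
    show "group (BijGroup X)" by (rule group_BijGroup)
    show "(\<lambda>a. \<lambda>x\<in>X. lam a x) \<in> hom (C\<lparr>carrier := H\<rparr>) (BijGroup X)"
      using bij HA X st
      by (auto simp: hom_def BijGroup_def compose_def fun_eq_iff restrict_def lam_circ subset_iff)
  qed
qed

lemma card_fixed_cong:
  assumes H: "subgroup H C" and p: "prime p" "card H = p ^ k"
    and X: "X \<subseteq> carrier A" "finite X" and st: "\<And>a x. \<lbrakk>a \<in> H; x \<in> X\<rbrakk> \<Longrightarrow> lam a x \<in> X"
  shows "[card X = card {x \<in> X. \<forall>a\<in>H. lam a x = x}] (mod p)"
proof -
  interpret group_action "C\<lparr>carrier := H\<rparr>" X "\<lambda>a. \<lambda>x\<in>X. lam a x"
    by (rule group_action_lam[OF H X(1) st])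
  show ?thesis
    using card_fixed_points_cong[OF X(2) p(1)] p(2)
    by (simp add: order_def cong: conj_cong)
qed

text \<open>Pigeonhole version of the orbit-stabilizer theorem.\<close>
lemma ex_nonzero_fixing:
  assumes H: "subgroup H C" and y: "y \<in> carrier A"
    and X: "finite X" "\<And>a. a \<in> H \<Longrightarrow> lam a y \<in> X" "card X < card H"
  shows "\<exists>a\<in>H. a \<noteq> \<zero> \<and> lam a y = y"
proof -
  have "\<not> inj_on (\<lambda>a. lam a y) H" using card_inj_on_le[of "\<lambda>a. lam a y" H X] X by fastforce
  then obtain a b where ab: "a \<in> H" "b \<in> H" "a \<noteq> b" "lam a y = lam b y" by (auto simp: inj_on_def)
  have A: "a \<in> carrier A" "b \<in> carrier A" using ab subgroup.subset[OF H] by auto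
  have "lam (circ A (inv\<^bsub>C\<^esub> a) b) y = y" using A y ab(4) by (simp add: lam_circ flip: ab(4))
  moreover have "circ A (inv\<^bsub>C\<^esub> a) b \<in> H"
    using subgroup.m_closed[OF H subgroup.m_inv_closed[OF H ab(1)] ab(2)] by simp
  moreover have "circ A (inv\<^bsub>C\<^esub> a) b \<noteq> \<zero>" using A ab(3)
    by (metis circ.inv_closed circ.inv_equality circ.inv_inv)
  ultimately show ?thesis by blast
qed

end

section \<open>Actions on left ideals of order \<open>q\<close> or \<open>q ^ 2\<close>\<close>

locale finite_left_brace = left_brace +
  assumes fin: "finite (carrier A)"
begin

lemma finite_left_ideal: "left_ideal I \<Longrightarrow> finite I"
  using fin left_ideal_subset finite_subset by blast

lemma card_add_subgroup_dvd:
  assumes I: "subgroup I (add_monoid A)" and J: "subgroup J (add_monoid A)" and "J \<subseteq> I"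
  shows "card J dvd card I"
proof -
  have "subgroup J ((add_monoid A)\<lparr>carrier := I\<rparr>)" by (rule add.subgroup_incl[OF J I \<open>J \<subseteq> I\<close>])
  then show ?thesis
    using group.lagrange[OF add.subgroup_imp_group[OF I]] by (fastforce simp: order_def dest: sym)
qed

lemma card_subgroup_circ_dvd:
  assumes I: "subgroup I C" and J: "subgroup J C" and "J \<subseteq> I"
  shows "card J dvd card I"
proof -
  have "subgroup J (C\<lparr>carrier := I\<rparr>)" by (rule circ.subgroup_incl[OF J I \<open>J \<subseteq> I\<close>])
  then show ?thesis
    using group.lagrange[OF circ.subgroup_imp_group[OF I]] by (fastforce simp: order_def dest: sym)
qed

text \<open>Let \<open>E\<close> be the fixed points of \<open>a\<close> alone. In the chain
  \<open>F \<subset> E \<subseteq> Q\<close> all orders are powers of \<open>q\<close>. The exponent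
  of \<open>F\<close> is at least 1, so that of \<open>E\<close> is at least 2, and
  \<open>k \<le> 2\<close> leaves only \<open>E = Q\<close>.\<close>

lemma fixed_eq_all_if_grows:
  assumes q: "prime q" and Q: "left_ideal Q" "card Q = q ^ k" "k \<le> 2"
    and H: "subgroup H C"
    and F: "F = {b \<in> Q. \<forall>a\<in>H. lam a b = b}" "card F > 1"
    and y: "y \<in> Q - F" and a: "a \<in> H" "lam a y = y"
  shows "\<forall>b\<in>Q. lam a b = b"
proof -
  have aA: "a \<in> carrier A" using a(1) subgroup.subset[OF H] by auto
  define E where "E = {b \<in> Q. \<forall>c\<in>{a}. lam c b = b}"
  have sQ: "subgroup Q (add_monoid A)" using Q by (simp add: left_ideal_def)
  have sE: "subgroup E (add_monoid A)"
    unfolding E_def by (rule subgroup_fixed[OF sQ]) (use aA in simp)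
  have sF: "subgroup F (add_monoid A)"
    unfolding F(1) by (rule subgroup_fixed[OF sQ]) (use subgroup.subset[OF H] in simp)
  have EQ: "E \<subseteq> Q" and FE: "F \<subset> E" using F(1) y a by (auto simp: E_def)
  have finQ: "finite Q" using finite_left_ideal[OF Q(1)] .
  have "card F dvd card E" using card_add_subgroup_dvd[OF sE sF] FE by auto
  moreover have "card E dvd q ^ k" using card_add_subgroup_dvd[OF sQ sE EQ] Q by simp
  ultimately have "card F dvd q ^ k" "card E dvd q ^ k" by (auto intro: dvd_trans)
  then obtain i j where ij: "card F = q ^ i" "card E = q ^ j" "j \<le> k"
    using divides_primepow_nat[OF q] by auto
  have "card F < card E" using FE finQ EQ by (meson finite_subset psubset_card_mono)
  then have "i < j" using ij prime_gt_1_nat[OF q] by (simp add: power_strict_increasing_iff)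
  moreover have "i > 0" using ij F(2) by (cases i) auto
  ultimately have "j = k" using ij Q(3) by auto
  then have "E = Q" using ij Q EQ finQ by (metis card_subset_eq)
  then show ?thesis by (auto simp: E_def)
qed

text \<open>The points fixed by all of \<open>P\<close> include \<open>\<zero>\<close> and number a
  multiple of \<open>p\<close>, so there are at least \<open>p\<close> of them. A nonzero
  \<open>a\<close> that fixes one further point then fixes everything by
  \<open>fixed_eq_all_if_grows\<close>.\<close>

lemma ex_trivial_action_on_self:
  assumes p: "prime p" and P: "left_ideal P" "card P = p ^ k" "0 < k" "k \<le> 2"
  shows "\<exists>a\<in>P. a \<noteq> \<zero> \<and> (\<forall>b\<in>P. lam a b = b)"
proof -
  have sP: "subgroup P C" using left_ideal_imp_subgroup_circ[OF P(1)] .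
  have PA: "P \<subseteq> carrier A" and finP: "finite P" and zP: "\<zero> \<in> P"
    using left_ideal_subset[OF P(1)] finite_left_ideal[OF P(1)] left_ideal_zero[OF P(1)] .
  define F where "F = {b \<in> P. \<forall>a\<in>P. lam a b = b}"
  have cong: "[card P = card F] (mod p)" unfolding F_def
    by (rule card_fixed_cong[OF sP p P(2) PA finP]) (use left_ideal_lam[OF P(1)] PA in auto)
  then have "p dvd card F" using P(2,3) cong_dvd_iff[OF cong] by simp
  moreover have zF: "\<zero> \<in> F" using zP PA by (auto simp: F_def)
  moreover have finF: "finite F" using finP by (simp add: F_def)
  ultimately have F1: "card F > 1"
    using prime_gt_1_nat[OF p] dvd_imp_le[of p "card F"] by (cases "F = {}") (auto simp: card_gt_0_iff)
  have P1: "card P > 1" using one_less_power[OF prime_gt_1_nat[OF p] P(3)] P(2) by simp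
  show ?thesis
  proof (cases "F = P")
    case True
    have "\<not> P \<subseteq> {\<zero>}" using P1 card_mono[of "{\<zero>}" P] by auto
    then obtain a where "a \<in> P" "a \<noteq> \<zero>" by auto
    then show ?thesis using True by (auto simp: F_def)
  next
    case False
    then obtain y where y: "y \<in> P - F" by (auto simp: F_def)
    \<comment> \<open>The orbit of \<open>y\<close> avoids \<open>\<zero>\<close>, since
      \<open>lam a\<close> is injective and fixes \<open>\<zero>\<close>. So it has fewer than
      \<open>card P\<close> points and the pigeonhole applies.\<close>
    have "\<exists>a\<in>P. a \<noteq> \<zero> \<and> lam a y = y"
    proof (rule ex_nonzero_fixing[OF sP, where X = "P - {\<zero>}"])
      show "y \<in> carrier A" "finite (P - {\<zero>})" using y PA finP by auto
      show "card (P - {\<zero>}) < card P" using finP zP by (rule card_Diff1_less)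
      fix a assume a: "a \<in> P"
      have "lam a y \<noteq> \<zero>"
      proof
        assume "lam a y = \<zero>"
        then have "y = lam (inv\<^bsub>C\<^esub> a) \<zero>" using a y PA lam_inv_lam by (metis DiffD1 subsetD)
        then have "y = \<zero>" using a PA by auto
        then show False using y zF by auto
      qed
      then show "lam a y \<in> P - {\<zero>}" using left_ideal_lam[OF P(1)] a y PA by auto
    qed
    then show ?thesis
      using fixed_eq_all_if_grows[OF p P(1,2,4) sP F_def F1 y] by blast
  qed
qed

lemma trivial_action_coprime:
  assumes p: "prime p" and q: "prime q" "q < p" and ne: "\<not> (p = 3 \<and> q = 2)"
    and H: "subgroup H C" "card H = p ^ k"
    and Q: "left_ideal Q" "card Q = q ^ j" "j \<le> 2"
    and a: "a \<in> H" and b: "b \<in> Q"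
  shows "lam a b = b"
proof -
  define F where "F = {b \<in> Q. \<forall>a\<in>H. lam a b = b}"
  have HA: "H \<subseteq> carrier A" using subgroup.subset[OF H(1)] by auto
  have QA: "Q \<subseteq> carrier A" and finQ: "finite Q"
    using left_ideal_subset[OF Q(1)] finite_left_ideal[OF Q(1)] .
  have sQ: "subgroup Q (add_monoid A)" using Q by (simp add: left_ideal_def)
  have sF: "subgroup F (add_monoid A)"
    unfolding F_def by (rule subgroup_fixed[OF sQ HA])
  have FQ: "F \<subseteq> Q" by (auto simp: F_def)
  have cong: "[card Q = card F] (mod p)" unfolding F_def
    by (rule card_fixed_cong[OF H(1) p H(2) QA finQ]) (use left_ideal_lam[OF Q(1)] HA in auto)
  obtain i where i: "card F = q ^ i" "i \<le> j"
    using card_add_subgroup_dvd[OF sQ sF FQ] Q(2) divides_primepow_nat[OF q(1)] by auto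
  have q1: "q > 1" using prime_gt_1_nat[OF q(1)] .
  have cop: "coprime (q ^ i) p" using p q
    by (simp add: primes_coprime)
  \<comment> \<open>If \<open>F\<close> were proper, cancelling \<open>q ^ i\<close> in the
    congruence would give that \<open>p\<close> divides \<open>q - 1\<close> or
    \<open>q ^ 2 - 1\<close>.\<close>
  have "j = i"
  proof (rule ccontr)
    assume "j \<noteq> i"
    then have ij: "i < j" using i by simp
    have "[q ^ i * q ^ (j - i) = q ^ i * 1] (mod p)"
      using cong i Q(2) by (simp flip: power_add)
    then have "[q ^ (j - i) = 1] (mod p)" using cop cong_mult_lcancel_nat by blast
    then have d: "p dvd q ^ (j - i) - 1" using q1 by (simp add: cong_altdef_nat)
    have "j - i = 1 \<or> j - i = 2" using ij Q(3) by auto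
    then show False
    proof
      assume "j - i = 1"
      then show False using d q1 q(2) by (auto dest!: dvd_imp_le)
    next
      assume "j - i = 2"
      moreover have "q ^ 2 - 1 = (q - 1) * (q + 1)" using q1 by (simp add: power2_eq_square algebra_simps)
      ultimately have "p dvd q - 1 \<or> p dvd q + 1" using d p by (metis prime_dvd_mult_iff)
      \<comment> \<open>As \<open>p > q\<close>, it cannot divide \<open>q - 1\<close> and divides
        \<open>q + 1\<close> only by equality; the only consecutive primes are 2 and 3.\<close>
      then have "p = q + 1" using q1 q(2) by (auto dest!: dvd_imp_le)
      moreover from this have "q = 2"
        using prime_odd_nat[OF p] prime_odd_nat[OF q(1)] q1 by (cases "q = 2") auto
      ultimately show False using ne by simp
    qed
  qed
  then have "F = Q" using i Q(2) FQ finQ by (simp add: card_subset_eq)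
  then show ?thesis using a b by (auto simp: F_def)
qed

section \<open>Primary components of the additive group\<close>

definition component :: "nat \<Rightarrow> 'a set" where
  "component p = {x \<in> carrier A. [(p ^ multiplicity p (card (carrier A)))] \<cdot> x = \<zero>}"

text \<open>Additive maps commute with multiples, so elements killed by a fixed multiple are mapped
  to such elements.\<close>

lemma left_ideal_component: "left_ideal (component p)"
proof -
  let ?n = "p ^ multiplicity p (card (carrier A))"
  have "subgroup (component p) (add_monoid A)"
  proof (rule add.subgroupI)
    show "component p \<subseteq> carrier A" by (auto simp: component_def)
    show "component p \<noteq> {}" by (auto simp: component_def intro!: exI[of _ \<zero>])
    show "\<ominus> a \<in> component p" if "a \<in> component p" for a
      using that by (simp add: component_def add.nat_pow_inv)
    show "a \<oplus> b \<in> component p" if "a \<in> component p" "b \<in> component p" for a b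
      using that by (simp add: component_def add.nat_pow_distrib)
  qed
  then show ?thesis
    by (auto simp: left_ideal_def component_def simp flip: lam_add_pow)
qed

text \<open>No prime other than \<open>p\<close> divides the order of the component, so it is a
  power of \<open>p\<close> dividing \<open>card (carrier A)\<close>. Conversely a Sylow
  \<open>p\<close>-subgroup is killed by its own order and therefore lies in the component.\<close>

lemma card_component:
  assumes p: "prime p"
  shows "card (component p) = p ^ multiplicity p (card (carrier A))"
proof -
  let ?n = "card (carrier A)" let ?k = "multiplicity p ?n"
  have LI: "left_ideal (component p)" by (rule left_ideal_component)
  have sub: "subgroup (component p) (add_monoid A)" using LI by (simp add: left_ideal_def)
  have finc: "finite (component p)" using finite_left_ideal[OF LI] .
  have n0: "?n \<noteq> 0" using fin zero_closed by auto
  have only: "q = p" if q: "prime q" "q dvd card (component p)" for q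
  proof (rule ccontr)
    assume "q \<noteq> p"
    then have cop: "coprime q (p ^ ?k)" using p q by (simp add: primes_coprime)
    obtain m where m: "card (component p) = q ^ 1 * m" using q by auto
    have grp: "group ((add_monoid A)\<lparr>carrier := component p\<rparr>)" using add.subgroup_imp_group[OF sub] .
    \<comment> \<open>Sylow with exponent 1 serves as Cauchy's theorem: it yields a nonzero element
      killed both by \<open>q\<close> and by a power of \<open>p\<close>.\<close>
    obtain S where S: "subgroup S ((add_monoid A)\<lparr>carrier := component p\<rparr>)" "card S = q ^ 1"
      using sylow_thm[OF q(1) grp _ , of 1 m] m finc by (auto simp: order_def)
    have SA: "subgroup S (add_monoid A)" and Sc: "S \<subseteq> component p"
      using add.incl_subgroup[OF sub S(1)] subgroup.subset[OF S(1)] by auto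
    have "\<not> S \<subseteq> {\<zero>}" using S(2) prime_gt_1_nat[OF q(1)] card_mono[of "{\<zero>}" S] by auto
    then obtain x where x: "x \<in> S" "x \<noteq> \<zero>" by auto
    have xA: "x \<in> carrier A" using x Sc by (auto simp: component_def)
    have "group ((add_monoid A)\<lparr>carrier := S\<rparr>)" using add.subgroup_imp_group[OF SA] .
    then have "x [^]\<^bsub>(add_monoid A)\<lparr>carrier := S\<rparr>\<^esub> card S = \<zero>"
      using group.pow_order_eq_1[of "(add_monoid A)\<lparr>carrier := S\<rparr>" x] x by (simp add: order_def)
    then have qx: "[q] \<cdot> x = \<zero>"
      using S(2) by (simp add: add_pow_def nat_pow_def)
    have px: "[(p ^ ?k)] \<cdot> x = \<zero>" using x Sc by (auto simp: component_def)
    have "add.ord x dvd q" "add.ord x dvd p ^ ?k"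
      using qx px add.pow_eq_id[OF xA] by auto
    then have "add.ord x = 1" using cop by (metis coprime_def nat_dvd_1_iff_1)
    then show False using add.ord_eq_1[OF xA] x by simp
  qed
  have cpos: "card (component p) > 0" using left_ideal_zero[OF LI] finc by (auto simp: card_gt_0_iff)
  obtain j where j: "card (component p) = p ^ j"
  proof
    let ?c = "card (component p)"
    have "prime_factorization ?c = replicate_mset (multiplicity p ?c) p"
      by (rule multiset_eqI) (use only p cpos in \<open>auto simp: count_prime_factorization intro: not_dvd_imp_multiplicity_0\<close>)
    then show "?c = p ^ multiplicity p ?c" using cpos prod_mset_prime_factorization_nat[of ?c] by simp
  qed
  have sA: "subgroup (carrier A) (add_monoid A)" using add.subgroup_self by simp
  have "p ^ j dvd ?n" using card_add_subgroup_dvd[OF sA sub] j by (auto simp: component_def)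
  then have "j \<le> ?k" using n0 prime_gt_1_nat[OF p] by (intro multiplicity_geI) auto
  obtain m where m: "?n = p ^ ?k * m" using multiplicity_dvd by blast
  obtain S where S: "subgroup S (add_monoid A)" "card S = p ^ ?k"
    using sylow_thm[OF p a_group, of ?k m] m fin by (auto simp: order_def)
  have "S \<subseteq> component p"
  proof
    fix x assume x: "x \<in> S"
    have "group ((add_monoid A)\<lparr>carrier := S\<rparr>)" using add.subgroup_imp_group[OF S(1)] .
    then have "x [^]\<^bsub>(add_monoid A)\<lparr>carrier := S\<rparr>\<^esub> card S = \<zero>"
      using group.pow_order_eq_1[of "(add_monoid A)\<lparr>carrier := S\<rparr>" x] x by (simp add: order_def)
    then have "[(p ^ ?k)] \<cdot> x = \<zero>"
      using S(2) by (simp add: add_pow_def nat_pow_def)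
    then show "x \<in> component p" using x subgroup.subset[OF S(1)] by (auto simp: component_def)
  qed
  then have "p ^ ?k \<le> p ^ j" using card_mono[OF finc] S(2) j by metis
  then have "?k \<le> j" using prime_gt_1_nat[OF p] by simp
  then show ?thesis using j \<open>j \<le> ?k\<close> by simp
qed

text \<open>By Lagrange the full power of each prime in \<open>card (carrier A)\<close> divides
  \<open>card X\<close>.\<close>

lemma eq_carrier_if_components:
  assumes X: "subgroup X (add_monoid A)" and c: "\<And>q. prime q \<Longrightarrow> component q \<subseteq> X"
  shows "X = carrier A"
proof -
  have XA: "X \<subseteq> carrier A" using subgroup.subset[OF X] by simp
  have finX: "finite X" using XA fin finite_subset by blast
  have X0: "card X \<noteq> 0" using subgroup.one_closed[OF X] finX by auto
  have "card (carrier A) dvd card X"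
  proof (rule multiplicity_le_imp_dvd)
    show "card (carrier A) \<noteq> 0" using fin zero_closed by auto
    fix q :: nat assume q: "prime q"
    have "subgroup (component q) (add_monoid A)" using left_ideal_component by (simp add: left_ideal_def)
    then have "q ^ multiplicity q (card (carrier A)) dvd card X"
      using card_add_subgroup_dvd[OF X _ c[OF q]] card_component[OF q] by simp
    then show "multiplicity q (card (carrier A)) \<le> multiplicity q (card X)"
      using X0 prime_gt_1_nat[OF q] by (intro multiplicity_geI) auto
  qed
  then have "card (carrier A) \<le> card X" using X0 by (simp add: dvd_imp_le)
  then show ?thesis using XA fin by (simp add: card_seteq)
qed

end

section \<open>Comparing the actions of two left ideals\<close>

context left_brace
begin

text \<open>The induction varies \<open>b\<close>, since each factor of the power moves it;
  stability of \<open>V\<close> keeps \<open>eq\<close> applicable.\<close>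

lemma lam_nat_pow_eq:
  fixes n :: nat
  assumes V: "left_ideal V" and t: "t \<in> carrier A" and v: "v \<in> carrier A"
    and eq: "\<And>b. b \<in> V \<Longrightarrow> lam t b = lam v b" and b: "b \<in> V"
  shows "lam (t [^]\<^bsub>C\<^esub> n) b = lam (v [^]\<^bsub>C\<^esub> n) b"
  using b
proof (induction n arbitrary: b)
  case 0
  then show ?case by simp
next
  case (Suc n)
  have bA: "b \<in> carrier A" and vb: "lam v b \<in> V"
    using Suc.prems left_ideal_subset[OF V] left_ideal_lam[OF V v] by auto
  have "lam (t [^]\<^bsub>C\<^esub> Suc n) b = lam (t [^]\<^bsub>C\<^esub> n) (lam t b)"
    using t bA by (simp add: lam_circ)
  also have "\<dots> = lam (v [^]\<^bsub>C\<^esub> n) (lam v b)"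
    using eq[OF Suc.prems] Suc.IH[OF vb] by simp
  also have "\<dots> = lam (v [^]\<^bsub>C\<^esub> Suc n) b" using v bA by (simp add: lam_circ)
  finally show ?case .
qed

text \<open>This rewrites \<open>v \<circ> w = v + \<lambda>\<^sub>v(w)\<close> as \<open>w' \<circ> v'\<close> with \<open>w' = \<lambda>\<^sub>v(w)\<close>.\<close>
lemma lam_matched_pair:
  assumes A: "v \<in> carrier A" "w \<in> carrier A" "v' \<in> carrier A" "b \<in> carrier A"
    and v': "lam (lam v w) v' = v"
  shows "lam v (lam w b) = lam (lam v w) (lam v' b)"
proof -
  have "circ A v w = circ A (lam v w) v'"
    using A v' by (simp add: circ_eq_add_lam a_comm)
  then show ?thesis using A by (simp flip: lam_circ)
qed

lemma subgroup_circ_pow_card: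
  assumes H: "subgroup H C" and a: "a \<in> H"
  shows "a [^]\<^bsub>C\<^esub> card H = \<zero>"
proof -
  have "a [^]\<^bsub>C\<lparr>carrier := H\<rparr>\<^esub> card H = \<zero>"
    using group.pow_order_eq_1[OF circ.subgroup_imp_group[OF H], of a] a by (simp add: order_def)
  then show ?thesis by (simp add: nat_pow_def)
qed

text \<open>Choose an exponent divisible by \<open>card W\<close> and congruent to 1 modulo
  \<open>card V\<close>. That circle power of \<open>t\<close> is \<open>\<zero>\<close> and that of
  \<open>v\<close> is \<open>v\<close>, while both act alike on \<open>V\<close>.\<close>

lemma trivial_action_if_coprime_eq:
  assumes V: "left_ideal V" and W: "left_ideal W" and cop: "coprime (card V) (card W)" "card W \<noteq> 0"
    and t: "t \<in> W" and v: "v \<in> V" and eq: "\<And>b. b \<in> V \<Longrightarrow> lam t b = lam v b" and b: "b \<in> V"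
  shows "lam v b = b"
proof -
  have tA: "t \<in> carrier A" and vA: "v \<in> carrier A" and bA: "b \<in> carrier A"
    using t v b left_ideal_subset[OF V] left_ideal_subset[OF W] by auto
  have sV: "subgroup V C" and sW: "subgroup W C"
    using left_ideal_imp_subgroup_circ V W by auto
  obtain d m l where d: "d dvd card W" "d dvd card V" "card W * m = card V * l + d"
    using bezout_add_strong_nat[of "card W" "card V"] cop(2) by blast
  then have ml: "card W * m = card V * l + 1" using cop(1) coprime_common_divisor_nat by metis
  have "lam (t [^]\<^bsub>C\<^esub> (card W * m)) b = lam (v [^]\<^bsub>C\<^esub> (card W * m)) b"
    by (rule lam_nat_pow_eq[OF V tA vA eq b])
  moreover have "t [^]\<^bsub>C\<^esub> (card W * m) = \<zero>"
    using subgroup_circ_pow_card[OF sW t] tA circ.nat_pow_one by (simp flip: circ.nat_pow_pow)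
  moreover have "v [^]\<^bsub>C\<^esub> (card W * m) = v"
  proof -
    have "v [^]\<^bsub>C\<^esub> (card V * l) = \<zero>"
      using subgroup_circ_pow_card[OF sV v] vA circ.nat_pow_one by (simp flip: circ.nat_pow_pow)
    then show ?thesis using vA by (simp add: ml)
  qed
  ultimately show ?thesis using bA by simp
qed

end

section \<open>The exceptional primes 2 and 3\<close>

context finite_left_brace
begin

lemma exceptional_case:
  assumes V: "left_ideal V" "card V = 2 ^ i" "0 < i" "i \<le> 2"
    and W: "left_ideal W" "card W = 3 ^ j" "0 < j" "j \<le> 2"
  shows "\<exists>a\<in>carrier A. a \<noteq> \<zero> \<and> (\<forall>b\<in>V \<union> W. lam a b = b)"
proof (cases "\<forall>w\<in>W. \<forall>v\<in>V. lam w v = v")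
  case True
  \<comment> \<open>If \<open>W\<close> acts trivially on \<open>V\<close>, an element of
    \<open>W\<close> acting trivially on \<open>W\<close> is enough.\<close>
  have "prime (3::nat)" by simp
  then obtain a where "a \<in> W" "a \<noteq> \<zero>" "\<forall>b\<in>W. lam a b = b"
    using ex_trivial_action_on_self[OF _ W] by blast
  then show ?thesis using True left_ideal_subset[OF W(1)] by blast
next
  case False
  then obtain w0 v0 where w0: "w0 \<in> W" "v0 \<in> V" "lam w0 v0 \<noteq> v0" by auto
  have p2: "prime (2::nat)" and p3: "prime (3::nat)" by simp_all
  have VA: "V \<subseteq> carrier A" and WA: "W \<subseteq> carrier A"
    using left_ideal_subset V(1) W(1) by auto
  have finV: "finite V" and finW: "finite W"
    using finite_left_ideal V(1) W(1) by auto
  have sV: "subgroup V C" and sW: "subgroup W C"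
    using left_ideal_imp_subgroup_circ V(1) W(1) by auto
  have zV: "\<zero> \<in> V" and zW: "\<zero> \<in> W" using left_ideal_zero V(1) W(1) by auto
  have stV: "lam a b \<in> V" if "a \<in> carrier A" "b \<in> V" for a b using left_ideal_lam[OF V(1) that] .
  have stW: "lam a b \<in> W" if "a \<in> carrier A" "b \<in> W" for a b using left_ideal_lam[OF W(1) that] .
  \<comment> \<open>\<open>card V\<close> and \<open>card FV\<close> agree modulo 3. As
    \<open>FV\<close> is nonempty and proper, \<open>card V = 2\<close> is impossible and
    \<open>card V = 4\<close> leaves only \<open>card FV = 1\<close>.\<close>
  define FV where "FV = {v \<in> V. \<forall>w\<in>W. lam w v = v}"
  have zFV: "\<zero> \<in> FV" using zV WA by (auto simp: FV_def)
  have cV: "card V = 2 \<or> card V = 4" using V(2-4) by (auto simp: le_Suc_eq numeral_2_eq_2)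
  have FV: "FV = {\<zero>}" and cV4: "card V = 4"
  proof -
    have cong: "[card V = card FV] (mod 3)" unfolding FV_def
      by (rule card_fixed_cong[OF sW p3 W(2) VA finV]) (use stV WA in auto)
    moreover have "card FV < card V"
      by (rule psubset_card_mono[OF finV]) (use w0 in \<open>auto simp: FV_def\<close>)
    moreover have "card FV > 0" using zFV finV by (auto simp: card_gt_0_iff FV_def)
    ultimately have "card FV \<in> {1, 2, 3}" using cV by auto
    then have "card FV = 1 \<and> card V = 4"
      using cV cong \<open>card FV < card V\<close> by (auto simp: cong_def)
    then show "FV = {\<zero>}" "card V = 4" using zFV by (auto simp: card_1_singleton_iff)
  qed
  \<comment> \<open>\<open>S\<close> is the socle of \<open>V\<close> as a brace in its own
    right.\<close>
  define S where "S = {v \<in> V. \<forall>b\<in>V. lam v b = b}"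
  have S_stable: "lam u v \<in> S" if u: "u \<in> W" and v: "v \<in> S" for u v
  proof -
    \<comment> \<open>These choices give \<open>circ A v w = circ A u1 v'\<close>. As
      \<open>v\<close> acts trivially on \<open>V\<close>, the element \<open>circ A u w\<close> of
      \<open>W\<close> acts on \<open>V\<close> exactly as \<open>v'\<close> does, and coprimality
      of the orders makes \<open>v'\<close> act trivially.\<close>
    define u1 where "u1 = inv\<^bsub>C\<^esub> u"
    define w where "w = lam (inv\<^bsub>C\<^esub> v) u1"
    define v' where "v' = lam u v"
    have A: "u \<in> carrier A" "v \<in> carrier A" and vV: "v \<in> V" using u v WA VA by (auto simp: S_def)
    have u1: "u1 \<in> W" unfolding u1_def using subgroup.m_inv_closed[OF sW u] .
    have wW: "w \<in> W" unfolding w_def using stW u1 A by simp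
    have v'V: "v' \<in> V" unfolding v'_def using stV A vV by simp
    have A2: "u1 \<in> carrier A" "w \<in> carrier A" "v' \<in> carrier A" using u1 wW v'V WA VA by auto
    have lvw: "lam v w = u1" unfolding w_def using A A2 by simp
    have v'e: "lam u1 v' = v" unfolding u1_def v'_def using A by simp
    have t: "circ A u w \<in> W" using subgroup.m_closed[OF sW u wW] by simp
    have eq: "lam (circ A u w) b = lam v' b" if b: "b \<in> V" for b
    proof -
      have bA: "b \<in> carrier A" using b VA by auto
      have "lam w b = lam v (lam w b)" using v stV[OF A2(2) b] by (simp add: S_def)
      also have "\<dots> = lam u1 (lam v' b)"
        using lam_matched_pair[OF A(2) A2(2,3) bA] lvw v'e by simp
      finally show ?thesis using A A2 bA by (simp add: lam_circ u1_def)
    qed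
    have "coprime (card V) (card W)" "card W \<noteq> 0" using V(2) W(2) by (simp_all add: coprime_power_left_iff coprime_power_right_iff)
    then have "\<forall>b\<in>V. lam v' b = b"
      using trivial_action_if_coprime_eq[OF V(1) W(1) _ _ t v'V eq] by blast
    then show ?thesis using v'V by (simp add: S_def v'_def)
  qed
  have "S = V"
  proof -
    have SV: "S \<subseteq> V" by (auto simp: S_def)
    have finS: "finite S" using finV SV finite_subset by blast
    have zS: "\<zero> \<in> S" using zV VA by (auto simp: S_def)
    \<comment> \<open>\<open>W\<close> fixes only \<open>\<zero>\<close> in \<open>S\<close>, so
      \<open>card S\<close> is 1 modulo 3; lying between 2 and 4, it is 4.\<close>
    have "[card S = card {v \<in> S. \<forall>w\<in>W. lam w v = v}] (mod 3)"
      by (rule card_fixed_cong[OF sW p3 W(2) _ finS]) (use SV VA S_stable in auto)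
    moreover have "{v \<in> S. \<forall>w\<in>W. lam w v = v} = {\<zero>}"
      using FV zS SV zFV by (auto simp: FV_def)
    ultimately have "[card S = 1] (mod 3)" by simp
    moreover obtain a where "a \<in> V" "a \<noteq> \<zero>" "\<forall>b\<in>V. lam a b = b"
      using ex_trivial_action_on_self[OF p2 V] by blast
    then have "{\<zero>, a} \<subseteq> S" "card {\<zero>, a} = 2"
      using zS by (auto simp: S_def)
    then have "2 \<le> card S" using card_mono[OF finS] by metis
    moreover have "card S \<le> 4" using card_mono[OF finV SV] cV4 by simp
    ultimately have "card S = 4" by (simp add: cong_def) presburger
    then show ?thesis using cV4 SV finV by (simp add: card_subset_eq)
  qed
  then have Vtriv: "lam v b = b" if "v \<in> V" "b \<in> V" for v b using that by (auto simp: S_def)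
  \<comment> \<open>\<open>X w\<close> is the fibre through \<open>w\<close> of the map from
    \<open>W\<close> to the automorphisms of \<open>V\<close>; \<open>X \<zero>\<close> is the
    kernel.\<close>
  define X where "X w = {u \<in> W. \<forall>b\<in>V. lam u b = lam w b}" for w
  have X_stable: "lam v u \<in> X w" if v: "v \<in> V" and u: "u \<in> X w" and w: "w \<in> W" for v u w
  proof -
    have A: "v \<in> carrier A" "u \<in> carrier A" "u \<in> W" using v u VA WA by (auto simp: X_def)
    \<comment> \<open>The choice of \<open>v'\<close> gives
      \<open>circ A v u = circ A w' v'\<close>. Both \<open>v\<close> and \<open>v'\<close> act
      trivially on \<open>V\<close>, so \<open>u\<close> and \<open>w'\<close> act alike
      there.\<close>
    define w' where "w' = lam v u"
    define v' where "v' = lam (inv\<^bsub>C\<^esub> w') v"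
    have w': "w' \<in> W" unfolding w'_def using stW A by simp
    have w'A: "w' \<in> carrier A" using w' WA by auto
    have v': "v' \<in> V" unfolding v'_def using stV w'A v by simp
    have "lam w' b = lam w b" if b: "b \<in> V" for b
    proof -
      have bA: "b \<in> carrier A" using b VA by auto
      have "lam v (lam u b) = lam w' (lam v' b)"
        unfolding w'_def by (rule lam_matched_pair) (use A bA v v' VA w'A in \<open>auto simp: v'_def simp flip: w'_def\<close>)
      then have "lam u b = lam w' b" using Vtriv[OF v stV[OF A(2) b]] Vtriv[OF v' b] by simp
      then show ?thesis using u b by (simp add: X_def)
    qed
    then show ?thesis using w' by (simp add: X_def w'_def)
  qed
  have sK: "subgroup (X \<zero>) C"
  proof (rule circ.subgroupI)
    show "X \<zero> \<subseteq> carrier A" using WA by (auto simp: X_def)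
    show "X \<zero> \<noteq> {}" using zW by (auto simp: X_def)
    fix a assume a: "a \<in> X \<zero>"
    then have aW: "a \<in> W" and aA: "a \<in> carrier A" and afix: "\<And>b. b \<in> V \<Longrightarrow> lam a b = b"
      using WA VA by (auto simp: X_def)
    have "lam (inv\<^bsub>C\<^esub> a) b = b" if "b \<in> V" for b
      using lam_inv_lam[of a b] afix[OF that] aA that VA by auto
    then show "inv\<^bsub>C\<^esub> a \<in> X \<zero>"
      using subgroup.m_inv_closed[OF sW aW] VA by (auto simp: X_def)
    fix b assume b: "b \<in> X \<zero>"
    then show "circ A a b \<in> X \<zero>"
      using subgroup.m_closed[OF sW aW, of b] afix aA VA WA
      by (auto simp: X_def lam_circ subset_iff)
  qed
  \<comment> \<open>The kernel misses \<open>w0\<close> and \<open>card W\<close> is at most 9, so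
    its order is 1 or 3.\<close>
  have cK: "odd (card (X \<zero>))" "card (X \<zero>) \<le> 3"
  proof -
    have "card (X \<zero>) dvd 3 ^ j"
      using card_subgroup_circ_dvd[OF sW sK] W(2) by (auto simp: X_def)
    then obtain k where k: "card (X \<zero>) = 3 ^ k" using divides_primepow_nat[OF p3] by auto
    have "w0 \<notin> X \<zero>" using w0 subsetD[OF VA w0(2)] by (auto simp: X_def intro!: bexI[of _ v0])
    then have "card (X \<zero>) < card W" by (intro psubset_card_mono[OF finW]) (use w0 in \<open>auto simp: X_def\<close>)
    then have "k < j" using k W(2) by simp
    then have "k = 0 \<or> k = 1" using W(4) by auto
    then show "odd (card (X \<zero>))" "card (X \<zero>) \<le> 3" using k by auto
  qed
  \<comment> \<open>Fibres are circle cosets of the kernel.\<close>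
  have cX: "card (X w) = card (X \<zero>)" if w: "w \<in> W" for w
  proof -
    have wA: "w \<in> carrier A" using w WA by auto
    have iw: "inv\<^bsub>C\<^esub> w \<in> W" using subgroup.m_inv_closed[OF sW w] .
    have "bij_betw (circ A w) (X \<zero>) (X w)"
    proof (rule bij_betw_byWitness[where f' = "circ A (inv\<^bsub>C\<^esub> w)"])
      show "\<forall>a\<in>X \<zero>. circ A (inv\<^bsub>C\<^esub> w) (circ A w a) = a"
        using WA wA by (auto simp: X_def simp flip: circ.m_assoc)
      show "\<forall>a\<in>X w. circ A w (circ A (inv\<^bsub>C\<^esub> w) a) = a"
        using WA wA by (auto simp: X_def simp flip: circ.m_assoc)
      show "circ A w ` X \<zero> \<subseteq> X w"
        using subgroup.m_closed[OF sW w] wA VA WA by (auto simp: X_def lam_circ subset_iff)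
      show "circ A (inv\<^bsub>C\<^esub> w) ` X w \<subseteq> X \<zero>"
        using subgroup.m_closed[OF sW iw] wA VA WA by (auto simp: X_def lam_circ subset_iff)
    qed
    then show ?thesis by (simp add: bij_betw_same_card)
  qed
  have finX: "finite (X w)" for w using finW by (simp add: X_def)
  define F where "F = {w \<in> W. \<forall>v\<in>V. lam v w = w}"
  have zF: "\<zero> \<in> F" using zW VA by (auto simp: F_def)
  have F1: "card F > 1"
  proof -
    \<comment> \<open>The 2-group \<open>V\<close> acts on the fibre through \<open>w0\<close>,
      which has odd order and so contains a fixed point. This point is nonzero because
      \<open>w0\<close> moves \<open>v0\<close>, so that \<open>\<zero>\<close> lies in a different
      fibre.\<close>
    let ?Y = "{x \<in> X w0. \<forall>v\<in>V. lam v x = x}"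
    have "[card (X w0) = card ?Y] (mod 2)"
      by (rule card_fixed_cong[OF sV p2 V(2) _ finX])
        (use WA X_stable w0 in \<open>auto simp: X_def\<close>)
    then have "odd (card ?Y)"
      using cK(1) cX[OF w0(1)] cong_dvd_iff[of "card (X w0)" "card ?Y" 2] by simp
    then have "?Y \<noteq> {}" by (intro notI) (simp only: card.empty even_zero not_True_eq_False)
    then obtain x where x: "x \<in> X w0" "\<forall>v\<in>V. lam v x = x" by blast
    have "x \<in> F" using x by (auto simp: F_def X_def)
    moreover have "x \<noteq> \<zero>" 
      using x(1) w0(2,3) bspec[of V "\<lambda>b. lam x b = lam w0 b" v0] subsetD[OF VA w0(2)]
      by (intro notI) (simp add: X_def)
    moreover have "finite F" using finW by (simp add: F_def)
    ultimately have "card {\<zero>, x} \<le> card F"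
      using zF by (intro card_mono) auto
    then show ?thesis using \<open>x \<noteq> \<zero>\<close> by simp
  qed
  have "\<exists>a\<in>V. a \<noteq> \<zero> \<and> (\<forall>b\<in>W. lam a b = b)"
  proof (cases "F = W")
    case True
    obtain a where "a \<in> V" "a \<noteq> \<zero>"
      using ex_trivial_action_on_self[OF p2 V] by blast
    then show ?thesis using True by (auto simp: F_def)
  next
    case False
    then obtain y where y: "y \<in> W - F" by (auto simp: F_def)
    \<comment> \<open>The orbit of \<open>y\<close> stays in its fibre, which has at most 3
      elements, while \<open>card V = 4\<close>.\<close>
    have "\<exists>a\<in>V. a \<noteq> \<zero> \<and> lam a y = y"
    proof (rule ex_nonzero_fixing[OF sV _ finX])
      show "y \<in> carrier A" using y WA by auto
      show "lam a y \<in> X y" if "a \<in> V" for a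
        using X_stable[OF that, of y y] y by (auto simp: X_def)
      show "card (X y) < card V" using cX[of y] y cK cV4 by auto
    qed
    then show ?thesis using fixed_eq_all_if_grows[OF p3 W(1,2,4) sV F_def F1 y] by blast
  qed
  then show ?thesis using Vtriv VA by blast
qed

end

section \<open>A nonzero element acting trivially on the whole brace\<close>

context finite_left_brace
begin

lemma ex_trivial_action:
  assumes cf: "cube_free (card (carrier A))" and ne: "carrier A \<noteq> {\<zero>}"
  shows "\<exists>a\<in>carrier A. a \<noteq> \<zero> \<and> (\<forall>b\<in>carrier A. lam a b = b)"
proof -
  let ?n = "card (carrier A)"
  define m where "m q = multiplicity q ?n" for q
  have n0: "?n \<noteq> 0" using cf by (simp add: cube_free_def)
  have m2: "m q \<le> 2" if q: "prime q" for q
  proof (rule ccontr)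
    assume "\<not> m q \<le> 2"
    then have "q ^ 3 dvd ?n" unfolding m_def by (intro multiplicity_dvd') simp
    then show False using cf q by (simp add: cube_free_def)
  qed
  have LI: "left_ideal (component q)" for q by (rule left_ideal_component)
  have card_comp: "card (component q) = q ^ m q" if "prime q" for q
    using card_component[OF that] by (simp add: m_def)
  have triv_comp: "component q = {\<zero>}" if "prime q" "m q = 0" for q
    using card_comp[of q] that left_ideal_zero[OF LI, of q] by (auto simp: card_1_singleton_iff)
  have m_dvd: "m q > 0 \<longleftrightarrow> q dvd ?n" if "prime q" for q
    using that n0 by (simp add: m_def prime_multiplicity_gt_zero_iff)
  define P where "P = {q. prime q \<and> q dvd ?n}"
  define p where "p = Max P"
  have finP: "finite P" using n0 by (simp add: P_def)
  have "?n \<noteq> 1" using ne zero_closed by (metis card_1_singletonE singletonD)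
  then have "P \<noteq> {}" using prime_factor_nat by (auto simp: P_def)
  then have "p \<in> P" using finP by (simp add: p_def)
  then have p: "prime p" "m p > 0" by (simp_all add: P_def m_dvd)
  have pmax: "q < p" if "prime q" "m q > 0" "q \<noteq> p" for q
    using that Max_ge[OF finP, of q] by (simp add: p_def P_def m_dvd)
  have "\<exists>a\<in>carrier A. a \<noteq> \<zero> \<and> (\<forall>q. prime q \<longrightarrow> (\<forall>b\<in>component q. lam a b = b))"
  \<comment> \<open>As \<open>p\<close> is the largest prime divisor, the case excluded from
    \<open>trivial_action_coprime\<close> can occur only if 2 and 3 are the only prime
    divisors.\<close>
  proof (cases "p = 3 \<and> m 2 > 0")
    case True
    have p2: "prime (2::nat)" and p3: "prime (3::nat)" by simp_all
    obtain a where a: "a \<in> carrier A" "a \<noteq> \<zero>" "\<forall>b\<in>component 2 \<union> component 3. lam a b = b"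
      using exceptional_case[OF LI card_comp[OF p2] _ m2[OF p2] LI card_comp[OF p3] _ m2[OF p3]]
        True p(2) by auto
    have "lam a b = b" if q: "prime q" and b: "b \<in> component q" for q b
    proof (cases "m q = 0")
      case True
      then show ?thesis using triv_comp[OF q True] b a(1) by simp
    next
      case False
      then have "q \<le> 3" using pmax[OF q] \<open>p = 3 \<and> m 2 > 0\<close> by force
      then have "q = 2 \<or> q = 3" using prime_ge_2_nat[OF q] by auto
      then show ?thesis using a(3) b by auto
    qed
    then show ?thesis using a by blast
  next
    case ne32: False
    \<comment> \<open>All of \<open>component p\<close> acts trivially on the other components, so
      \<open>a\<close> need only act trivially on \<open>component p\<close>.\<close>
    obtain a where a: "a \<in> component p" "a \<noteq> \<zero>" "\<forall>b\<in>component p. lam a b = b"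
      using ex_trivial_action_on_self[OF p(1) LI card_comp[OF p(1)] p(2) m2[OF p(1)]] by blast
    have aA: "a \<in> carrier A" using a(1) left_ideal_subset[OF LI] by auto
    have "lam a b = b" if q: "prime q" and b: "b \<in> component q" for q b
    proof (cases "m q = 0 \<or> q = p")
      case True
      then show ?thesis using triv_comp[OF q] b a aA by auto
    next
      case False
      show ?thesis
        by (rule trivial_action_coprime[OF p(1) q _ _ left_ideal_imp_subgroup_circ[OF LI]
              card_comp[OF p(1)] LI card_comp[OF q] m2[OF q] a(1) b])
          (use False ne32 pmax[OF q] in auto)
    qed
    then show ?thesis using a aA by blast
  qed
  then obtain a where a: "a \<in> carrier A" "a \<noteq> \<zero>"
    "\<And>q b. \<lbrakk>prime q; b \<in> component q\<rbrakk> \<Longrightarrow> lam a b = b" by blast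
  \<comment> \<open>The fixed points of \<open>a\<close> form an additive subgroup containing every
    component.\<close>
  have "{b \<in> carrier A. \<forall>c\<in>{a}. lam c b = b} = carrier A"
  proof (rule eq_carrier_if_components)
    show "subgroup {b \<in> carrier A. \<forall>c\<in>{a}. lam c b = b} (add_monoid A)"
      by (rule subgroup_fixed) (use a(1) add.subgroup_self in simp_all)
    show "component q \<subseteq> {b \<in> carrier A. \<forall>c\<in>{a}. lam c b = b}" if "prime q" for q
      using a(3)[OF that] left_ideal_subset[OF LI] by auto
  qed
  then show ?thesis using a by blast
qed

end

section \<open>The socle and congruence modulo it\<close>

context left_brace
begin

lemma socle_eq: "socle A = {a \<in> carrier A. \<forall>b\<in>carrier A. lam a b = b}"
proof -
  have "a \<otimes> b = \<zero> \<longleftrightarrow> lam a b = b" if "a \<in> carrier A" "b \<in> carrier A" for a b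
    using that brace_mult_closed by (simp add: lam_def)
  then show ?thesis by (auto simp: socle_def)
qed

text \<open>The kernel relation of the action; its classes turn out to be the additive cosets of the
  socle.\<close>

definition lam_equiv where
  "lam_equiv a b \<longleftrightarrow> (\<forall>c\<in>carrier A. lam a c = lam b c)"

lemma lam_equiv_socle_add:
  assumes s: "s \<in> socle A" and a: "a \<in> carrier A"
  shows "lam_equiv (s \<oplus> a) a"
proof -
  have "s \<oplus> a = circ A s a" using s a by (simp add: circ_eq_add_lam socle_eq)
  then show ?thesis using s a by (simp add: lam_equiv_def lam_circ socle_eq)
qed

text \<open>The circle quotient \<open>s\<close> of \<open>b\<close> by \<open>a\<close> acts
  trivially, and for such \<open>s\<close> the product \<open>circ A s a\<close> is
  \<open>s \<oplus> a\<close>.\<close>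

lemma lam_equiv_imp_socle_add:
  assumes a: "a \<in> carrier A" and b: "b \<in> carrier A" and eq: "lam_equiv b a"
  shows "\<exists>s\<in>socle A. b = s \<oplus> a"
proof -
  define s where "s = circ A b (inv\<^bsub>C\<^esub> a)"
  have sA: "s \<in> carrier A" using a b circ.m_closed by (simp add: s_def)
  have "lam s c = c" if c: "c \<in> carrier A" for c
    using a b c eq by (simp add: s_def lam_circ lam_equiv_def)
  then have s: "s \<in> socle A" using sA by (simp add: socle_eq)
  have "circ A s a = b" using a b by (simp add: s_def circ.m_assoc)
  then have "b = s \<oplus> a" using s a sA by (simp add: circ_eq_add_lam socle_eq)
  then show ?thesis using s by blast
qed

text \<open>\<open>circ A a s\<close> acts like \<open>a\<close>, so it equals
  \<open>t \<oplus> a\<close> with \<open>t\<close> in the socle; comparison with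
  \<open>a \<oplus> lam a s\<close> identifies \<open>t\<close>.\<close>

lemma lam_socle:
  assumes s: "s \<in> socle A" and a: "a \<in> carrier A"
  shows "lam a s \<in> socle A"
proof -
  have sA: "s \<in> carrier A" using s by (simp add: socle_eq)
  have "lam_equiv (circ A a s) a" using s a sA by (simp add: lam_equiv_def lam_circ socle_eq)
  then obtain t where t: "t \<in> socle A" "circ A a s = t \<oplus> a"
    using lam_equiv_imp_socle_add[OF a] a sA circ.m_closed by blast
  have "t \<in> carrier A" using t by (simp add: socle_eq)
  then have "t = lam a s" using t(2) a sA by (simp add: circ_eq_add_lam a_comm[of t])
  then show ?thesis using t by simp
qed

text \<open>On the socle addition and the circle operation coincide, so closure follows from that of
  the kernel of the action.\<close>

lemma subgroup_socle: "subgroup (socle A) (add_monoid A)"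
proof (rule add.subgroupI)
  show "socle A \<subseteq> carrier A" by (auto simp: socle_eq)
  show "socle A \<noteq> {}" by (auto simp: socle_eq intro!: exI[of _ \<zero>])
  fix s assume s: "s \<in> socle A"
  then have sA: "s \<in> carrier A" by (simp add: socle_eq)
  have "s \<oplus> inv\<^bsub>C\<^esub> s = \<zero>" using s sA circ_eq_add_lam[of s "inv\<^bsub>C\<^esub> s"] by (simp add: socle_eq)
  then have "\<ominus> s = inv\<^bsub>C\<^esub> s" using sA by (metis a_comm circ.inv_closed circ_monoid_simps(1) minus_equality)
  moreover have "lam (inv\<^bsub>C\<^esub> s) c = c" if "c \<in> carrier A" for c
    using s lam_inv_lam[OF sA that] that by (simp add: socle_eq)
  ultimately show "\<ominus> s \<in> socle A" using sA by (simp add: socle_eq)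
  fix t assume t: "t \<in> socle A"
  then have "s \<oplus> t = circ A s t" using s by (simp add: socle_eq circ_eq_add_lam)
  then show "s \<oplus> t \<in> socle A" using s t by (simp add: socle_eq lam_circ)
qed

lemma lam_equiv_add:
  assumes A: "a \<in> carrier A" "b \<in> carrier A" "a' \<in> carrier A" "b' \<in> carrier A"
    and eq: "lam_equiv a' a" "lam_equiv b' b"
  shows "lam_equiv (a' \<oplus> b') (a \<oplus> b)"
proof -
  obtain s t where st: "s \<in> socle A" "t \<in> socle A" "a' = s \<oplus> a" "b' = t \<oplus> b"
    using lam_equiv_imp_socle_add A eq by metis
  have "s \<in> carrier A" "t \<in> carrier A" using st by (simp_all add: socle_eq)
  then have "a' \<oplus> b' = (s \<oplus> t) \<oplus> (a \<oplus> b)" using st A by (simp add: a_ac)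
  moreover have "s \<oplus> t \<in> socle A" using add.subgroupE(4)[OF subgroup_socle] st by blast
  ultimately show ?thesis using lam_equiv_socle_add A by simp
qed

text \<open>With \<open>b' = t \<oplus> b\<close> and \<open>t\<close> in the socle, the two
  products differ by \<open>lam a t \<oplus> \<ominus> t\<close>, which is in the socle because the
  socle is stable under \<open>lam\<close>.\<close>

lemma lam_equiv_mult:
  assumes A: "a \<in> carrier A" "b \<in> carrier A" "a' \<in> carrier A" "b' \<in> carrier A"
    and eq: "lam_equiv a' a" "lam_equiv b' b"
  shows "lam_equiv (a' \<otimes> b') (a \<otimes> b)"
proof -
  obtain t where t: "t \<in> socle A" "b' = t \<oplus> b"
    using lam_equiv_imp_socle_add A eq by metis
  have tA: "t \<in> carrier A" using t by (simp add: socle_eq)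
  have lt: "lam a t \<in> socle A" using lam_socle t A by simp
  have mA: "a' \<otimes> b' \<in> carrier A" "a \<otimes> b \<in> carrier A" using A brace_mult_closed by auto
  have "a' \<otimes> b' \<oplus> b' = lam a b'" using eq A by (simp add: lam_equiv_def flip: lam_def)
  also have "\<dots> = lam a t \<oplus> (a \<otimes> b \<oplus> b)" using t tA A by (simp add: lam_add flip: lam_def)
  also have "\<dots> = lam a t \<oplus> \<ominus> t \<oplus> (a \<otimes> b) \<oplus> b'"
  proof -
    have "lam a t \<oplus> \<ominus> t \<oplus> (a \<otimes> b) \<oplus> (t \<oplus> b) = lam a t \<oplus> ((\<ominus> t \<oplus> t) \<oplus> (a \<otimes> b \<oplus> b))"
      using tA A mA by (simp only: a_ac lam_closed a_closed a_inv_closed)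
    then show ?thesis using t tA A mA by (simp add: l_neg)
  qed
  finally have "a' \<otimes> b' = lam a t \<oplus> \<ominus> t \<oplus> (a \<otimes> b)" using A tA mA by simp
  moreover have "lam a t \<oplus> \<ominus> t \<in> socle A"
    using add.subgroupE(3,4)[OF subgroup_socle] t lt by blast
  ultimately show ?thesis using lam_equiv_socle_add mA by simp
qed

section \<open>The quotient brace by the socle\<close>

lemma left_brace_image:
  fixes B :: "('c, 'd) ring_scheme"
  assumes surj: "h ` carrier A = carrier B"
    and add: "\<And>a b. \<lbrakk>a \<in> carrier A; b \<in> carrier A\<rbrakk> \<Longrightarrow> h (a \<oplus> b) = h a \<oplus>\<^bsub>B\<^esub> h b"
    and mult: "\<And>a b. \<lbrakk>a \<in> carrier A; b \<in> carrier A\<rbrakk> \<Longrightarrow> h (a \<otimes> b) = h a \<otimes>\<^bsub>B\<^esub> h b"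
    and zero: "h \<zero> = \<zero>\<^bsub>B\<^esub>"
  shows "left_brace B"
proof -
  have hB: "h a \<in> carrier B" if "a \<in> carrier A" for a using surj that by blast
  \<comment> \<open>Surjectivity lets every axiom of \<open>B\<close> be checked on preimages in
    \<open>A\<close>.\<close>
  have pre: "\<exists>a\<in>carrier A. x = h a" if "x \<in> carrier B" for x using surj that by blast
  have ab: "abelian_group B"
  proof (rule abelian_groupI)
    show "\<zero>\<^bsub>B\<^esub> \<in> carrier B" using hB[OF zero_closed] zero by simp
    show "x \<oplus>\<^bsub>B\<^esub> y \<in> carrier B" if "x \<in> carrier B" "y \<in> carrier B" for x y
      using that by (auto dest!: pre simp: hB simp flip: add)
    show "x \<oplus>\<^bsub>B\<^esub> y \<oplus>\<^bsub>B\<^esub> z = x \<oplus>\<^bsub>B\<^esub> (y \<oplus>\<^bsub>B\<^esub> z)"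
      if "x \<in> carrier B" "y \<in> carrier B" "z \<in> carrier B" for x y z
      using that by (auto dest!: pre simp: a_assoc simp flip: add)
    show "x \<oplus>\<^bsub>B\<^esub> y = y \<oplus>\<^bsub>B\<^esub> x" if "x \<in> carrier B" "y \<in> carrier B" for x y
      using that by (auto dest!: pre simp: a_comm simp flip: add)
    show "\<zero>\<^bsub>B\<^esub> \<oplus>\<^bsub>B\<^esub> x = x" if "x \<in> carrier B" for x
      using that by (auto dest!: pre simp flip: add zero)
    show "\<exists>y\<in>carrier B. y \<oplus>\<^bsub>B\<^esub> x = \<zero>\<^bsub>B\<^esub>" if x: "x \<in> carrier B" for x
    proof -
      obtain a where a: "a \<in> carrier A" "x = h a" using pre[OF x] by auto
      then have "h (\<ominus> a) \<oplus>\<^bsub>B\<^esub> x = \<zero>\<^bsub>B\<^esub>" by (simp add: l_neg flip: add zero)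
      then show ?thesis using hB a by blast
    qed
  qed
  have mB: "x \<otimes>\<^bsub>B\<^esub> y \<in> carrier B" if "x \<in> carrier B" "y \<in> carrier B" for x y
    using that by (auto dest!: pre simp: hB brace_mult_closed simp flip: mult)
  have hcirc: "circ B (h a) (h b) = h (circ A a b)" if "a \<in> carrier A" "b \<in> carrier A" for a b
    using that by (simp add: circ_def add mult brace_mult_closed)
  have cA: "circ A a b \<in> carrier A" if "a \<in> carrier A" "b \<in> carrier A" for a b
    using circ.m_closed that by simp
  have grp: "group (circ_monoid B)"
  proof (rule groupI)
    show "x \<otimes>\<^bsub>circ_monoid B\<^esub> y \<in> carrier (circ_monoid B)"
      if "x \<in> carrier (circ_monoid B)" "y \<in> carrier (circ_monoid B)" for x y
      using that by (auto dest!: pre simp: circ_monoid_def hB hcirc cA)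
    show "\<one>\<^bsub>circ_monoid B\<^esub> \<in> carrier (circ_monoid B)"
      using hB[OF zero_closed] zero by (simp add: circ_monoid_def)
    show "x \<otimes>\<^bsub>circ_monoid B\<^esub> y \<otimes>\<^bsub>circ_monoid B\<^esub> z = x \<otimes>\<^bsub>circ_monoid B\<^esub> (y \<otimes>\<^bsub>circ_monoid B\<^esub> z)"
      if "x \<in> carrier (circ_monoid B)" "y \<in> carrier (circ_monoid B)" "z \<in> carrier (circ_monoid B)" for x y z
      using that circ.m_assoc by (auto dest!: pre simp: circ_monoid_def hB hcirc cA)
    show "\<one>\<^bsub>circ_monoid B\<^esub> \<otimes>\<^bsub>circ_monoid B\<^esub> x = x" if "x \<in> carrier (circ_monoid B)" for x
      using that circ.l_one by (auto dest!: pre simp: circ_monoid_def hcirc simp flip: zero)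
    show "\<exists>y\<in>carrier (circ_monoid B). y \<otimes>\<^bsub>circ_monoid B\<^esub> x = \<one>\<^bsub>circ_monoid B\<^esub>"
      if x: "x \<in> carrier (circ_monoid B)" for x
    proof -
      obtain a where a: "a \<in> carrier A" "x = h a" using pre x by (auto simp: circ_monoid_def)
      have "circ B (h (inv\<^bsub>C\<^esub> a)) x = \<zero>\<^bsub>B\<^esub>" using a by (simp add: hcirc zero)
      then show ?thesis using hB[of "inv\<^bsub>C\<^esub> a"] a(1) circ.inv_closed[of a]
        by (intro bexI[of _ "h (inv\<^bsub>C\<^esub> a)"]) (simp_all add: circ_monoid_def)
    qed
  qed
  show ?thesis
  proof (intro left_brace.intro ab left_brace_axioms.intro mB grp)
    show "x \<otimes>\<^bsub>B\<^esub> (y \<oplus>\<^bsub>B\<^esub> z) = x \<otimes>\<^bsub>B\<^esub> y \<oplus>\<^bsub>B\<^esub> x \<otimes>\<^bsub>B\<^esub> z"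
      if xyz: "x \<in> carrier B" "y \<in> carrier B" "z \<in> carrier B" for x y z
    proof -
      obtain a b c where "a \<in> carrier A" "b \<in> carrier A" "c \<in> carrier A" "x = h a" "y = h b" "z = h c"
        using xyz pre by metis
      then show ?thesis by (simp add: brace_left_distrib brace_mult_closed flip: add mult)
    qed
  qed
qed

definition rep where "rep a = (SOME b. b \<in> carrier A \<and> lam_equiv b a)"

lemma rep: assumes "a \<in> carrier A" shows "rep a \<in> carrier A" "lam_equiv (rep a) a"
proof -
  have "a \<in> carrier A \<and> lam_equiv a a" using assms by (simp add: lam_equiv_def)
  from someI[where P="\<lambda>b. b \<in> carrier A \<and> lam_equiv b a", OF this]
  show "rep a \<in> carrier A" "lam_equiv (rep a) a" by (simp_all add: rep_def)
qed

text \<open>Equivalent elements give the same predicate to \<open>SOME\<close>, hence the same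
  choice.\<close>

lemma rep_eq: "lam_equiv a b \<Longrightarrow> rep a = rep b"
  unfolding rep_def lam_equiv_def by (rule arg_cong[where f = Eps]) auto

text \<open>The quotient by the socle, carried by representatives so that the type does not change.\<close>
definition socle_quotient where
  "socle_quotient = A\<lparr>carrier := rep ` carrier A, monoid.mult := \<lambda>a b. rep (a \<otimes> b),
     zero := rep \<zero>, add := \<lambda>a b. rep (a \<oplus> b)\<rparr>"

lemma socle_quotient_simps [simp]:
  "carrier socle_quotient = rep ` carrier A" "\<zero>\<^bsub>socle_quotient\<^esub> = rep \<zero>"
  by (simp_all add: socle_quotient_def)

lemma rep_add:
  "\<lbrakk>a \<in> carrier A; b \<in> carrier A\<rbrakk> \<Longrightarrow> rep (a \<oplus> b) = rep a \<oplus>\<^bsub>socle_quotient\<^esub> rep b"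
  by (simp add: socle_quotient_def rep_eq[OF lam_equiv_add] rep)

lemma rep_mult:
  "\<lbrakk>a \<in> carrier A; b \<in> carrier A\<rbrakk> \<Longrightarrow> rep (a \<otimes> b) = rep a \<otimes>\<^bsub>socle_quotient\<^esub> rep b"
  by (simp add: socle_quotient_def rep_eq[OF lam_equiv_mult] rep)

lemma left_brace_socle_quotient: "left_brace socle_quotient"
  by (rule left_brace_image[where h = rep]) (simp_all add: rep_add rep_mult)

text \<open>Every element is uniquely a socle element plus a chosen representative.\<close>

lemma card_socle_quotient: "card (carrier A) = card (socle A) * card (carrier socle_quotient)"
proof -
  have SA: "s \<in> carrier A" if "s \<in> socle A" for s using that by (simp add: socle_eq)
  have "bij_betw (\<lambda>(s, b). s \<oplus> b) (socle A \<times> rep ` carrier A) (carrier A)"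
    unfolding bij_betw_def
  proof (intro conjI inj_onI equalityI subsetI)
    fix x y assume x: "x \<in> socle A \<times> rep ` carrier A" and y: "y \<in> socle A \<times> rep ` carrier A"
      and eq: "(case x of (s, b) \<Rightarrow> s \<oplus> b) = (case y of (s, b) \<Rightarrow> s \<oplus> b)"
    obtain s a t b where d: "x = (s, rep a)" "y = (t, rep b)" "s \<in> socle A" "t \<in> socle A"
      "a \<in> carrier A" "b \<in> carrier A" using x y by auto
    have e: "s \<oplus> rep a = t \<oplus> rep b" using eq d by simp
    \<comment> \<open>Adding a socle element does not change the class, so \<open>rep\<close>
      recovers the representative from the sum.\<close>
    have rr: "rep (s \<oplus> rep a) = rep a" if "s \<in> socle A" "a \<in> carrier A" for s a
      using rep_eq[OF lam_equiv_socle_add, of s "rep a"] rep_eq[OF rep(2), of a] rep that by simp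
    have "rep a = rep b" using rr d e by metis
    then show "x = y" using d e SA rep by simp
  next
    fix x assume "x \<in> (\<lambda>(s, b). s \<oplus> b) ` (socle A \<times> rep ` carrier A)"
    then show "x \<in> carrier A" using SA rep by auto
  next
    fix x assume x: "x \<in> carrier A"
    have "lam_equiv x (rep x)" using rep(2)[OF x] by (simp add: lam_equiv_def)
    then obtain s where "s \<in> socle A" "x = s \<oplus> rep x"
      using lam_equiv_imp_socle_add[OF rep(1)[OF x] x] by blast
    then show "x \<in> (\<lambda>(s, b). s \<oplus> b) ` (socle A \<times> rep ` carrier A)" using x by force
  qed
  then show ?thesis by (metis bij_betw_same_card card_cartesian_product socle_quotient_simps(1))
qed

section \<open>The right series along the quotient map\<close>

lemma right_series_closed: "right_series A n \<subseteq> carrier A"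
proof (cases "(A, n)" rule: right_series.cases)
  case (3 A' m)
  then have n: "n = Suc (Suc m)" by simp
  have "right_series A (Suc k) \<subseteq> carrier A" for k
  proof (induction k)
    case (Suc k)
    then have "{x \<otimes> a | x a. x \<in> right_series A (Suc k) \<and> a \<in> carrier A} \<subseteq> carrier A"
      using brace_mult_closed by auto
    then show ?case using add.generate_incl by simp
  qed simp
  then show ?thesis using n by blast
qed auto

text \<open>\<open>rep\<close> preserves sums and products, so it maps the generators of each term
  to generators of the corresponding term.\<close>

lemma rep_right_series:
  "rep ` right_series A (Suc n) \<subseteq> right_series socle_quotient (Suc n)"
proof (induction n)
  case (Suc n)
  interpret B: left_brace socle_quotient by (rule left_brace_socle_quotient)
  have hom: "group_hom (add_monoid A) (add_monoid socle_quotient) rep"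
    unfolding group_hom_def group_hom_axioms_def hom_def
    using a_group B.a_group by (auto simp: rep_add)
  let ?G = "{x \<otimes> a | x a. x \<in> right_series A (Suc n) \<and> a \<in> carrier A}"
  let ?H = "{x \<otimes>\<^bsub>socle_quotient\<^esub> a | x a. x \<in> right_series socle_quotient (Suc n) \<and> a \<in> carrier socle_quotient}"
  have sub: "right_series A (Suc n) \<subseteq> carrier A" by (rule right_series_closed)
  have GA: "?G \<subseteq> carrier A" using sub brace_mult_closed by auto
  have "rep ` ?G \<subseteq> ?H"
  proof
    fix y assume "y \<in> rep ` ?G"
    then obtain x a where xa: "x \<in> right_series A (Suc n)" "a \<in> carrier A" "y = rep (x \<otimes> a)" by auto
    then have "y = rep x \<otimes>\<^bsub>socle_quotient\<^esub> rep a" using sub by (auto simp: rep_mult)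
    then show "y \<in> ?H" using xa Suc.IH by auto
  qed
  then have "generate (add_monoid socle_quotient) (rep ` ?G) \<subseteq> generate (add_monoid socle_quotient) ?H"
    by (rule B.add.mono_generate)
  then show ?case using group_hom.generate_img[OF hom, of ?G] GA by simp
qed simp

text \<open>If a term vanishes in the quotient, then the same term of \<open>A\<close> lies in the
  socle, so the next term of \<open>A\<close> is generated by zero products.\<close>

lemma finite_multipermutation_level_lift:
  assumes "finite_multipermutation_level socle_quotient"
  shows "finite_multipermutation_level A"
proof -
  obtain n where n: "right_series socle_quotient (Suc n) = {rep \<zero>}"
    using assms by (auto simp: finite_multipermutation_level_def dest!: Suc_le_D)
  have sub: "right_series A (Suc n) \<subseteq> carrier A" by (rule right_series_closed)
  have "x \<otimes> a = \<zero>" if x: "x \<in> right_series A (Suc n)" and a: "a \<in> carrier A" for x a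
  proof -
    have xA: "x \<in> carrier A" using x sub by auto
    have "rep x = rep \<zero>" using rep_right_series[of n] n x by auto
    then have "lam_equiv x \<zero>" using rep(2)[OF xA] rep(2)[OF zero_closed] by (simp add: lam_equiv_def)
    then have "lam x a = a" using a by (simp add: lam_equiv_def)
    then show ?thesis using a xA brace_mult_closed by (simp add: lam_def)
  qed
  then have "{x \<otimes> a | x a. x \<in> right_series A (Suc n) \<and> a \<in> carrier A} \<subseteq> {\<zero>}" by auto
  then have "right_series A (Suc (Suc n)) \<subseteq> generate (add_monoid A) {\<zero>}"
    using add.mono_generate by simp
  also have "\<dots> = {\<zero>}" by (rule add.generate_one)
  finally have "right_series A (Suc (Suc n)) = {\<zero>}"
    using generate.one[of "add_monoid A"] by auto
  then show ?thesis unfolding finite_multipermutation_level_def by (metis One_nat_def Suc_le_mono zero_le)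
qed

end

section \<open>Induction on the order of the brace\<close>

lemma socle_nonzero_if_cube_free:
  fixes A :: "('a, 'm) ring_scheme" (structure)
  assumes "left_brace A" "finite (carrier A)" "cube_free (card (carrier A))" "carrier A \<noteq> {\<zero>}"
  shows "socle A \<noteq> {\<zero>}"
proof -
  interpret finite_left_brace A using assms by (simp add: finite_left_brace_def finite_left_brace_axioms_def)
  show ?thesis using ex_trivial_action[OF assms(3,4)] by (auto simp: socle_eq)
qed

lemma cube_free_dvd: "\<lbrakk>cube_free n; d dvd n\<rbrakk> \<Longrightarrow> cube_free d"
  unfolding cube_free_def by (meson dvd_pos_nat dvd_trans)

lemma finite_multipermutation_level_if_cube_free:
  fixes A :: "('a, 'm) ring_scheme"
  assumes "left_brace A" "finite (carrier A)" "cube_free (card (carrier A))"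
  shows "finite_multipermutation_level A"
  using assms
\<comment> \<open>The brace itself varies; the induction hypothesis applies to the quotient because
  it has the same record type.\<close>
proof (induction "card (carrier A)" arbitrary: A rule: less_induct)
  case less
  interpret left_brace A by fact
  show ?case
  proof (cases "carrier A = {\<zero>\<^bsub>A\<^esub>}")
    case True
    then show ?thesis unfolding finite_multipermutation_level_def by (intro exI[of _ 1]) simp
  next
    case False
    have card: "card (carrier A) = card (socle A) * card (carrier socle_quotient)"
      by (rule card_socle_quotient)
    have pos: "card (carrier A) > 0" using less.prems by (simp add: cube_free_def)
    have "\<zero>\<^bsub>A\<^esub> \<in> socle A" by (simp add: socle_eq)
    \<comment> \<open>A nonzero socle makes the quotient strictly smaller, and its order divides
      that of \<open>A\<close>, so it is again cube-free.\<close>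
    then have "card (socle A) \<noteq> 1"
      using socle_nonzero_if_cube_free[OF less.prems False] by (auto simp: card_1_singleton_iff)
    then have "card (carrier socle_quotient) < card (carrier A)"
      using card pos by (cases "card (socle A)") auto
    moreover have "cube_free (card (carrier socle_quotient))"
      using cube_free_dvd[OF less.prems(3)] card by simp
    moreover have "finite (carrier socle_quotient)" using less.prems by simp
    ultimately have "finite_multipermutation_level socle_quotient"
      using less.hyps left_brace_socle_quotient by blast
    then show ?thesis by (rule finite_multipermutation_level_lift)
  qed
qed

theorem corollary9:
  fixes A :: "('a, 'm) ring_scheme" (structure)
  assumes "left_brace A"
    and "finite (carrier A)"
    and "cube_free (card (carrier A))"
  shows "(carrier A \<noteq> {\<zero>} \<longrightarrow> socle A \<noteq> {\<zero>}) \<and> finite_multipermutation_level A"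
  using socle_nonzero_if_cube_free[OF assms] finite_multipermutation_level_if_cube_free[OF assms]
  by blast

end
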